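(* Let $n\ge m\ge 3$ and let $F=(x_1^2+\cdots+x_m^2)(y_1^2+\cdots+y_n^2)\in\mathbb{C}[x_1,\ldots,x_m,y_1,\ldots,y_n]$. Then $$n(m+2)<\operatorname{Rk}F\le 2mn.$$
   Context: The Waring rank $\operatorname{Rk}F$ of a homogeneous polynomial $F$ of degree $d$ over $\mathbb{C}$ is the least integer $r$ such that $F=\sum_{i=1}^r\alpha_iL_i^d$ for some $\alpha_i\in\mathbb{C}$ and linear forms $L_i$. *)

theory Defs
  imports Complex_Main "HOL-Library.Poly_Mapping"
begin

(* Multivariate polynomials over the complex numbers with variables in 'v, as the monoid algebra
   of the monoid of exponent vectors 'v =>0 nat. *)
type_synonym 'v cpoly = "('v \<Rightarrow>\<^sub>0 nat) \<Rightarrow>\<^sub>0 complex"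

definition Const :: "complex \<Rightarrow> 'v cpoly" where
  "Const c = Poly_Mapping.single 0 c"

definition Var :: "'v \<Rightarrow> 'v cpoly" where
  "Var v = Poly_Mapping.single (Poly_Mapping.single v 1) 1"

definition homogeneous :: "'v set \<Rightarrow> nat \<Rightarrow> 'v cpoly \<Rightarrow> bool" where
  "homogeneous V d p \<longleftrightarrow> (\<forall>t \<in> Poly_Mapping.keys p.
     Poly_Mapping.keys t \<subseteq> V \<and> (\<Sum>v \<in> Poly_Mapping.keys t. Poly_Mapping.lookup t v) = d)"

definition linear_forms :: "'v set \<Rightarrow> 'v cpoly set" where
  "linear_forms V = {(\<Sum>v\<in>V. Const (c v) * Var v) | c. True}"

(* Waring rank of a form of degree d in the polynomial ring with finite variable set V.
   The degree is a parameter because the zero polynomial is homogeneous of every degree. *)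
definition waring_rank :: "'v set \<Rightarrow> nat \<Rightarrow> 'v cpoly \<Rightarrow> nat" where
  "waring_rank V d F = (LEAST r. \<exists>(\<alpha> :: nat \<Rightarrow> complex) (L :: nat \<Rightarrow> 'v cpoly).
     (\<forall>i<r. L i \<in> linear_forms V) \<and> F = (\<Sum>i<r. Const (\<alpha> i) * L i ^ d))"

(* The variables x_1, ..., x_m are Inl 1, ..., Inl m, and y_1, ..., y_n are Inr 1, ..., Inr n. *)
definition xy_vars :: "nat \<Rightarrow> nat \<Rightarrow> (nat + nat) set" where
  "xy_vars m n = {1..m} <+> {1..n}"

definition quadric_product :: "nat \<Rightarrow> nat \<Rightarrow> (nat + nat) cpoly" where
  "quadric_product m n = (\<Sum>i=1..m. Var (Inl i) ^ 2) * (\<Sum>j=1..n. Var (Inr j) ^ 2)"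

lemma Var_power2: "Var v ^ 2 = Poly_Mapping.single (Poly_Mapping.single v 2) 1"
  unfolding Var_def power2_eq_square mult_single single_add[symmetric] by (simp add: numeral_2_eq_2)

lemma homogeneous_quadric_product: "homogeneous (xy_vars m n) 4 (quadric_product m n)"
proof -
  let ?t = "\<lambda>i j. Poly_Mapping.single (Inl i) 2 + Poly_Mapping.single (Inr j) (2::nat)
    :: (nat + nat) \<Rightarrow>\<^sub>0 nat"
  have "quadric_product m n = (\<Sum>i=1..m. \<Sum>j=1..n. Poly_Mapping.single (?t i j) 1)"
    by (simp add: quadric_product_def Var_power2 sum_product mult_single)
  then have "Poly_Mapping.keys (quadric_product m n)
      \<subseteq> (\<Union>i\<in>{1..m}. Poly_Mapping.keys (\<Sum>j=1..n. Poly_Mapping.single (?t i j) (1::complex)))"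
    by (simp only: keys_sum)
  also have "\<dots> \<subseteq> (\<Union>i\<in>{1..m}. \<Union>j\<in>{1..n}. Poly_Mapping.keys (Poly_Mapping.single (?t i j) (1::complex)))"
    by (rule UN_mono[OF subset_refl keys_sum])
  finally have sub: "Poly_Mapping.keys (quadric_product m n) \<subseteq> (\<Union>i\<in>{1..m}. \<Union>j\<in>{1..n}. {?t i j})"
    by simp
  have k: "Poly_Mapping.keys (?t i j) = {Inl i, Inr j}" for i j :: nat
    by (auto simp: in_keys_iff lookup_add lookup_single when_def split: if_splits)
  have d: "(\<Sum>v\<in>{Inl i, Inr j}. Poly_Mapping.lookup (?t i j) v) = 4" for i j :: nat
    by (simp add: lookup_add lookup_single)
  show ?thesis
    unfolding homogeneous_def xy_vars_def
  proof
    fix t assume "t \<in> Poly_Mapping.keys (quadric_product m n)"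
    with sub obtain i j where "i \<in> {1..m}" "j \<in> {1..n}" "t = ?t i j" by blast
    then show "Poly_Mapping.keys t \<subseteq> {1..m} <+> {1..n} \<and>
        (\<Sum>v\<in>Poly_Mapping.keys t. Poly_Mapping.lookup t v) = 4"
      by (simp only: k d) auto
  qed
qed

end

theory Submission
  imports Defs
begin

text \<open>
  Write \<open>q\<^sub>x\<close> and \<open>q\<^sub>y\<close> for the two quadrics, so that \<open>F = q\<^sub>x q\<^sub>y\<close>.

  \<^bold>\<open>Upper bound.\<close> The sum \<open>(x + c y)\<^sup>4 + (x - c y)\<^sup>4\<close> is \<open>12 c\<^sup>2 x\<^sup>2 y\<^sup>2\<close> plus the pure powers
  \<open>2 x\<^sup>4\<close> and \<open>2 c\<^sup>4 y\<^sup>4\<close>. Doing this for every product \<open>x\<^sub>i\<^sup>2 y\<^sub>j\<^sup>2\<close> with its own parameter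
  \<open>s i j = c\<^sup>2\<close> writes \<open>F\<close> as \<open>2 m n\<close> fourth powers up to multiples of \<open>x\<^sub>i\<^sup>4\<close> and \<open>y\<^sub>j\<^sup>4\<close>. The total
  coefficients of these are proportional to \<open>\<Sum>\<^sub>j 1 / s i j\<close> and \<open>\<Sum>\<^sub>i s i j\<close>, and all of them vanish for
  \<open>s i j = \<omega>\<^sup>i \<zeta>\<^sup>j\<close> with nontrivial roots of unity \<open>\<omega>\<close> and \<open>\<zeta>\<close> (\<open>quadric_product_decomposition\<close>).

  \<^bold>\<open>Lower bound.\<close> A decomposition \<open>F = \<Sum>\<^sub>p \<alpha>\<^sub>p L\<^sub>p\<^sup>4\<close> turns the coefficients of \<open>L\<^sub>p\<close> into points, and
  comparing coefficients says that the weighted sum \<open>E\<close> over these points of a quartic monomial in the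
  coordinates is, up to a multinomial factor, the coefficient of that monomial in \<open>F\<close>
  (\<open>moment_of_power_sum\<close>). Discard the points whose \<open>y\<close>-part is zero, which contribute nothing to
  monomials that contain some \<open>y\<^sub>j\<close>, and rescale the others so that a generic linear form in \<open>y\<close> has the
  value 1 on all of them. Then moments of lower degree are determined as well.
  On the set \<open>S\<close> of remaining points, the \<open>n (m + 2)\<close> functions \<open>y\<^sub>k\<close>, \<open>y\<^sub>k x\<^sub>i\<close>, \<open>y\<^sub>k x\<^sub>1\<^sup>2\<close> are linearly
  independent, because pairing a relation under \<open>E\<close> successively with \<open>y\<^sub>j\<close>, \<open>x\<^sub>l y\<^sub>j\<close> and \<open>x\<^sub>1\<^sup>2 y\<^sub>j\<close> isolates
  its coefficients (\<open>relation_coefficients_zero\<close>, \<open>y_independent\<close>). Hence \<open>S\<close> has at least \<open>n (m + 2)\<close> points.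

  Equality is excluded as follows. If \<open>S\<close> had only \<open>n (m + 2)\<close> points, every function on \<open>S\<close> would be a
  combination of those functions, and for \<open>x\<^sub>i x\<^sub>l\<close> with \<open>i \<noteq> l\<close> and for \<open>x\<^sub>1\<^sup>2 - x\<^sub>3\<^sup>2\<close> the same pairings
  show that only the \<open>y\<^sub>k\<close> occur: these functions lie in the span \<open>W\<close> of the \<open>y\<^sub>k\<close>
  (\<open>in_W_if_few_points\<close>). But different \<open>x\<^sub>i\<close> are independent over \<open>W\<close> (\<open>x_independent_over_W\<close>), so
  \<open>(x\<^sub>2 x\<^sub>3) x\<^sub>1 = (x\<^sub>1 x\<^sub>3) x\<^sub>2\<close> forces \<open>x\<^sub>2 x\<^sub>3 = 0\<close> on \<open>S\<close>; likewise \<open>x\<^sub>1 x\<^sub>2\<close> and \<open>x\<^sub>1 x\<^sub>3\<close> vanish, and then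
  \<open>(x\<^sub>1\<^sup>2 - x\<^sub>3\<^sup>2) x\<^sub>2 = 0\<close> forces \<open>x\<^sub>1\<^sup>2 = x\<^sub>3\<^sup>2\<close>. So \<open>x\<^sub>1\<^sup>3 = x\<^sub>1 x\<^sub>3\<^sup>2 = 0\<close>, that is \<open>x\<^sub>1 = 0\<close> on \<open>S\<close>, which contradicts
  the nonzero coefficient of \<open>x\<^sub>1\<^sup>2 y\<^sub>1\<^sup>2\<close> (\<open>card_gt\<close>).
\<close>

section \<open>Linear algebra on a finite set of points\<close>

text \<open>
  Gaussian elimination, one point at a time: a function that is nonzero at the new point is used to
  clear the values of all others there. The functions form a family, so repetitions are allowed.
\<close>
lemma exists_nontrivial_relation:
  fixes f :: "'k \<Rightarrow> 'p \<Rightarrow> 'a::field"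
  assumes "finite S" "finite K" "card S < card K"
  shows "\<exists>c. (\<exists>k\<in>K. c k \<noteq> 0) \<and> (\<forall>p\<in>S. (\<Sum>k\<in>K. c k * f k p) = 0)"
  using assms
proof (induction S arbitrary: K f rule: finite_induct)
  case empty
  then have "K \<noteq> {}" by auto
  then show ?case by (intro exI[of _ "\<lambda>_. 1"]) auto
next
  case (insert s S)
  show ?case
  proof (cases "\<forall>k\<in>K. f k s = 0")
    case True
    have "card S < card K" using insert by simp
    from insert.IH[OF insert.prems(1) this, of f] True show ?thesis by auto
  next
    case False
    then obtain k0 where k0: "k0 \<in> K" "f k0 s \<noteq> 0" by blast
    let ?K = "K - {k0}"
    define g where "g k p = f k p - f k s / f k0 s * f k0 p" for k p
    have "card S < card ?K" using insert k0 by simp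
    then obtain c where c: "\<exists>k\<in>?K. c k \<noteq> 0" "\<And>p. p \<in> S \<Longrightarrow> (\<Sum>k\<in>?K. c k * g k p) = 0"
      using insert.IH[of ?K g] insert.prems by auto
    define c0 where "c0 = - (\<Sum>k\<in>?K. c k * f k s) / f k0 s"
    have split: "(\<Sum>k\<in>K. (c(k0 := c0)) k * f k p) = c0 * f k0 p + (\<Sum>k\<in>?K. c k * f k p)" for p
    proof -
      have "(\<Sum>k\<in>?K. (c(k0 := c0)) k * f k p) = (\<Sum>k\<in>?K. c k * f k p)"
        by (rule sum.cong) auto
      then show ?thesis using sum.remove[OF insert.prems(1) k0(1), of "\<lambda>k. (c(k0 := c0)) k * f k p"] by simp
    qed
    have g_sum: "(\<Sum>k\<in>?K. c k * g k p) = c0 * f k0 p + (\<Sum>k\<in>?K. c k * f k p)" for p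
      by (simp add: g_def c0_def right_diff_distrib sum_subtractf sum_distrib_left sum_distrib_right
          sum_divide_distrib mult_ac)
    have "(\<Sum>k\<in>K. (c(k0 := c0)) k * f k p) = 0" if "p \<in> insert s S" for p
    proof (cases "p = s")
      case True
      then show ?thesis using split[of s] k0 by (simp add: c0_def)
    next
      case False
      then show ?thesis using split[of p] g_sum[of p] c(2) that by simp
    qed
    moreover have "\<exists>k\<in>K. (c(k0 := c0)) k \<noteq> 0" using c(1) by auto
    ultimately show ?thesis by blast
  qed
qed

text \<open>
  On the moment curve \<open>c = (z, z\<^sup>2, \<dots>, z\<^sup>n)\<close> each nonzero vector \<open>b p\<close> gives a nonzero polynomial in \<open>z\<close>,
  so only finitely many values of \<open>z\<close> are bad.
\<close>
lemma exists_form_avoiding_zeros: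
  fixes b :: "'p \<Rightarrow> nat \<Rightarrow> complex"
  assumes "finite S" and nz: "\<And>p. p \<in> S \<Longrightarrow> \<exists>k\<in>{1..n}. b p k \<noteq> 0"
  shows "\<exists>c. \<forall>p\<in>S. (\<Sum>k=1..n. c k * b p k) \<noteq> 0"
proof -
  \<comment> \<open>The constant term is zero; the powers of \<open>z\<close> start at 1.\<close>
  define B where "B p k = (if k = 0 then 0 else b p k)" for p k
  have eq: "(\<Sum>k\<le>n. B p k * z ^ k) = (\<Sum>k=1..n. z ^ k * b p k)" for p z
    by (rule sum.mono_neutral_cong_right) (auto simp: B_def)
  have "finite {z. (\<Sum>k=1..n. z ^ k * b p k) = 0}" if "p \<in> S" for p
  proof -
    obtain k where "k \<in> {1..n}" "b p k \<noteq> 0" using nz[OF \<open>p \<in> S\<close>] by blast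
    then have "k \<le> n" "B p k \<noteq> 0" by (auto simp: B_def)
    then have "finite {z. (\<Sum>k\<le>n. B p k * z ^ k) = 0}"
      using polyfun_finite_roots[of "B p" n] by blast
    then show ?thesis by (simp only: eq)
  qed
  then have fin: "finite (\<Union>p\<in>S. {z. (\<Sum>k=1..n. z ^ k * b p k) = 0})" (is "finite ?Z")
    using assms(1) by blast
  obtain z where "z \<notin> ?Z"
    by (rule exE[OF ex_new_if_finite[OF infinite_UNIV_char_0 fin]])
  then show ?thesis by (intro exI[of _ "\<lambda>k. z ^ k"]) auto
qed

section \<open>Point sets with the quartic moments of a product of two quadrics\<close>

text \<open>
  Weighted points \<open>(x p, y p)\<close> on which the linear form with coefficients \<open>c\<close> in the \<open>y\<close>-coordinates is
  constantly 1 and whose quartic moments, for monomials containing some \<open>y\<^sub>j\<close>, are those of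
  \<open>q\<^sub>x q\<^sub>y\<close> up to one common factor. The monomials in \<open>x\<close> alone are left out because their moments
  change when points with \<open>y = 0\<close> are discarded.
\<close>
locale biquadratic_moments =
  fixes m n :: nat and S :: "'p set" and \<beta> :: "'p \<Rightarrow> complex"
    and x y :: "'p \<Rightarrow> nat \<Rightarrow> complex" and c :: "nat \<Rightarrow> complex" and \<kappa> :: complex
  assumes fin: "finite S"
    and m3: "3 \<le> m" and n1: "1 \<le> n" and \<kappa>: "\<kappa> \<noteq> 0"
    and t1: "p \<in> S \<Longrightarrow> (\<Sum>k=1..n. c k * y p k) = 1"
    and y4: "\<lbrakk>j \<in> {1..n}; k \<in> {1..n}; l \<in> {1..n}; q \<in> {1..n}\<rbrakk>
      \<Longrightarrow> (\<Sum>p\<in>S. \<beta> p * (y p j * y p k * y p l * y p q)) = 0"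
    and xy3: "\<lbrakk>i \<in> {1..m}; j \<in> {1..n}; k \<in> {1..n}; l \<in> {1..n}\<rbrakk>
      \<Longrightarrow> (\<Sum>p\<in>S. \<beta> p * (x p i * y p j * y p k * y p l)) = 0"
    and x2y2: "\<lbrakk>i \<in> {1..m}; l \<in> {1..m}; j \<in> {1..n}; k \<in> {1..n}\<rbrakk>
      \<Longrightarrow> (\<Sum>p\<in>S. \<beta> p * (x p i * x p l * y p j * y p k)) = (if i = l \<and> j = k then \<kappa> else 0)"
    and x3y: "\<lbrakk>i \<in> {1..m}; l \<in> {1..m}; q \<in> {1..m}; j \<in> {1..n}\<rbrakk>
      \<Longrightarrow> (\<Sum>p\<in>S. \<beta> p * (x p i * x p l * x p q * y p j)) = 0"
begin

definition E :: "('p \<Rightarrow> complex) \<Rightarrow> complex" where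
  "E h = (\<Sum>p\<in>S. \<beta> p * h p)"

lemma E_cong: "(\<And>p. p \<in> S \<Longrightarrow> f p = g p) \<Longrightarrow> E f = E g"
  by (simp add: E_def)

lemma E_0 [simp]: "E (\<lambda>p. 0) = 0"
  by (simp add: E_def)

lemma E_add: "E (\<lambda>p. f p + g p) = E f + E g"
  by (simp add: E_def algebra_simps sum.distrib)

lemma E_diff: "E (\<lambda>p. f p - g p) = E f - E g"
  by (simp add: E_def algebra_simps sum_subtractf)

lemma E_scale: "E (\<lambda>p. a * f p) = a * E f"
  by (simp add: E_def sum_distrib_left mult_ac)

lemma E_sum: "E (\<lambda>p. \<Sum>k\<in>K. f k p) = (\<Sum>k\<in>K. E (f k))"
  unfolding E_def sum_distrib_left by (rule sum.swap)

text \<open>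
  Inserting the form that is 1 on \<open>S\<close> homogenises: moments of lower degree reduce to quartic ones.
\<close>
lemma E_raise_degree: "E h = (\<Sum>k=1..n. c k * E (\<lambda>p. h p * y p k))"
proof -
  have "E h = E (\<lambda>p. \<Sum>k=1..n. c k * (h p * y p k))"
  proof (rule E_cong)
    fix p assume "p \<in> S"
    have "(\<Sum>k=1..n. c k * (h p * y p k)) = h p * (\<Sum>k=1..n. c k * y p k)"
      by (simp add: sum_distrib_left mult_ac)
    then show "h p = (\<Sum>k=1..n. c k * (h p * y p k))" using t1[OF \<open>p \<in> S\<close>] by simp
  qed
  then show ?thesis by (simp add: E_sum E_scale)
qed

lemma E_yyyy: "\<lbrakk>j \<in> {1..n}; k \<in> {1..n}; l \<in> {1..n}; q \<in> {1..n}\<rbrakk> \<Longrightarrow> E (\<lambda>p. y p j * y p k * y p l * y p q) = 0"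
  unfolding E_def by (rule y4)

lemma E_xyyy: "\<lbrakk>i \<in> {1..m}; j \<in> {1..n}; k \<in> {1..n}; l \<in> {1..n}\<rbrakk> \<Longrightarrow> E (\<lambda>p. x p i * y p j * y p k * y p l) = 0"
  unfolding E_def by (rule xy3)

lemma E_xxyy: "\<lbrakk>i \<in> {1..m}; l \<in> {1..m}; j \<in> {1..n}; k \<in> {1..n}\<rbrakk>
    \<Longrightarrow> E (\<lambda>p. x p i * x p l * y p j * y p k) = (if i = l \<and> j = k then \<kappa> else 0)"
  unfolding E_def by (rule x2y2)

lemma E_xxxy: "\<lbrakk>i \<in> {1..m}; l \<in> {1..m}; q \<in> {1..m}; j \<in> {1..n}\<rbrakk> \<Longrightarrow> E (\<lambda>p. x p i * x p l * x p q * y p j) = 0"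
  unfolding E_def by (rule x3y)

lemma E_yyy: "\<lbrakk>j \<in> {1..n}; k \<in> {1..n}; l \<in> {1..n}\<rbrakk> \<Longrightarrow> E (\<lambda>p. y p j * y p k * y p l) = 0"
  by (subst E_raise_degree) (simp add: E_yyyy)

lemma E_yy: "\<lbrakk>j \<in> {1..n}; k \<in> {1..n}\<rbrakk> \<Longrightarrow> E (\<lambda>p. y p j * y p k) = 0"
  by (subst E_raise_degree) (simp add: E_yyy)

lemma E_xyy: "\<lbrakk>i \<in> {1..m}; j \<in> {1..n}; k \<in> {1..n}\<rbrakk> \<Longrightarrow> E (\<lambda>p. x p i * y p j * y p k) = 0"
  by (subst E_raise_degree) (simp add: E_xyyy)

lemma E_xxy: "\<lbrakk>i \<in> {1..m}; l \<in> {1..m}; j \<in> {1..n}\<rbrakk>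
    \<Longrightarrow> E (\<lambda>p. x p i * x p l * y p j) = (if i = l then c j * \<kappa> else 0)"
proof -
  assume *: "i \<in> {1..m}" "l \<in> {1..m}" "j \<in> {1..n}"
  have "E (\<lambda>p. x p i * x p l * y p j) = (\<Sum>k=1..n. c k * E (\<lambda>p. x p i * x p l * y p j * y p k))"
    by (rule E_raise_degree)
  also have "\<dots> = (\<Sum>k=1..n. if k = j then (if i = l then c j * \<kappa> else 0) else 0)"
    by (intro sum.cong refl) (use * in \<open>auto simp: E_xxyy\<close>)
  finally show ?thesis using * by simp
qed

text \<open>
  The functions \<open>1, x\<^sub>1, \<dots>, x\<^sub>m, x\<^sub>1\<^sup>2\<close>, numbered \<open>0, \<dots>, m + 1\<close>; multiplied by the \<open>y\<^sub>k\<close> they give the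
  \<open>n (m + 2)\<close> functions that are shown to be independent. They represent a basis of the algebra of
  differential operators in \<open>x\<close> modulo those that annihilate \<open>q\<^sub>x\<close>.
\<close>
definition \<phi> :: "nat \<Rightarrow> 'p \<Rightarrow> complex" where
  "\<phi> s p = (if s = 0 then 1 else if s \<le> m then x p s else x p 1 * x p 1)"

lemma E_\<phi>_y:
  assumes "s \<le> m + 1" "k \<in> {1..n}" "j \<in> {1..n}"
  shows "E (\<lambda>p. \<phi> s p * y p k * y p j) = (if s = m + 1 \<and> k = j then \<kappa> else 0)"
proof -
  consider "s = 0" | "s \<in> {1..m}" | "s = m + 1" using assms(1) by fastforce
  then show ?thesis
  proof cases
    case 1
    then show ?thesis using assms by (simp add: \<phi>_def E_yy)
  next
    case 2
    then have "\<phi> s = (\<lambda>p. x p s)" by (auto simp: \<phi>_def)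
    then show ?thesis using 2 assms by (simp add: E_xyy)
  next
    case 3
    then have "\<phi> s = (\<lambda>p. x p 1 * x p 1)" by (auto simp: \<phi>_def)
    then show ?thesis using 3 assms m3 by (simp add: E_xxyy)
  qed
qed

lemma E_\<phi>_xy:
  assumes "s \<le> m" "k \<in> {1..n}" "j \<in> {1..n}" "l \<in> {1..m}"
  shows "E (\<lambda>p. \<phi> s p * y p k * (x p l * y p j)) = (if s = l \<and> k = j then \<kappa> else 0)"
proof -
  have "E (\<lambda>p. \<phi> s p * y p k * (x p l * y p j)) =
      (if s = 0 then E (\<lambda>p. x p l * y p k * y p j) else E (\<lambda>p. x p s * x p l * y p k * y p j))"
    using assms(1) by (auto simp: \<phi>_def mult_ac)
  then show ?thesis using assms by (auto simp: E_xyy E_xxyy)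
qed

text \<open>
  Pairing with \<open>y\<^sub>j\<close> sees only the coefficient of \<open>y\<^sub>j x\<^sub>1\<^sup>2\<close>, since all other products have moment zero.
  Once these coefficients are gone, pairing with \<open>x\<^sub>l y\<^sub>j\<close> sees only the coefficient of \<open>y\<^sub>j x\<^sub>l\<close>. The
  hypotheses on \<open>f\<close> make it invisible to both pairings.
\<close>
lemma relation_coefficients_zero:
  assumes rel: "\<And>p. p \<in> S \<Longrightarrow> a * f p + (\<Sum>s\<le>m+1. \<Sum>k=1..n. w s k * (\<phi> s p * y p k)) = 0"
    and fy: "\<And>j. j \<in> {1..n} \<Longrightarrow> E (\<lambda>p. f p * y p j) = 0"
    and fxy: "\<And>j l. \<lbrakk>j \<in> {1..n}; l \<in> {1..m}\<rbrakk> \<Longrightarrow> E (\<lambda>p. f p * (x p l * y p j)) = 0"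
    and s: "1 \<le> s" "s \<le> m + 1" and k: "k \<in> {1..n}"
  shows "w s k = 0"
proof -
  have test: "a * E (\<lambda>p. f p * h p) + (\<Sum>s\<le>m+1. \<Sum>k=1..n. w s k * E (\<lambda>p. \<phi> s p * y p k * h p)) = 0" for h
  proof -
    have "a * E (\<lambda>p. f p * h p) + (\<Sum>s\<le>m+1. \<Sum>k=1..n. w s k * E (\<lambda>p. \<phi> s p * y p k * h p))
      = E (\<lambda>p. (a * f p + (\<Sum>s\<le>m+1. \<Sum>k=1..n. w s k * (\<phi> s p * y p k))) * h p)"
      unfolding distrib_right sum_distrib_right mult.assoc[of a] mult.assoc[of "w _ _"]
        E_add E_scale E_sum ..
    also have "\<dots> = E (\<lambda>p. 0)" by (rule E_cong) (simp only: rel mult_zero_left)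
    finally show ?thesis by simp
  qed
  have delta: "(\<Sum>s\<le>m+1. \<Sum>k=1..n. if s = s0 \<and> k = j then w s k * \<kappa> else 0) = w s0 j * \<kappa>"
    if "s0 \<le> m + 1" "j \<in> {1..n}" for s0 j
  proof -
    have "(\<Sum>k=1..n. if s = s0 \<and> k = j then w s k * \<kappa> else 0) = (if s = s0 then w s j * \<kappa> else 0)" for s
      using that by (cases "s = s0") auto
    then show ?thesis using that by simp
  qed
  \<comment> \<open>Removing the \<open>x\<^sub>1\<^sup>2\<close> part first keeps the next pairing from meeting moments of degree five.\<close>
  have top: "w (m + 1) j = 0" if j: "j \<in> {1..n}" for j
  proof -
    have "(\<Sum>s\<le>m+1. \<Sum>k=1..n. w s k * E (\<lambda>p. \<phi> s p * y p k * y p j))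
      = (\<Sum>s\<le>m+1. \<Sum>k=1..n. if s = m + 1 \<and> k = j then w s k * \<kappa> else 0)"
      by (intro sum.cong refl) (use j in \<open>auto simp: E_\<phi>_y\<close>)
    then show ?thesis using test[of "\<lambda>p. y p j"] fy[OF j] delta[of "m + 1" j] j \<kappa> by simp
  qed
  have mid: "w l j = 0" if l: "l \<in> {1..m}" and j: "j \<in> {1..n}" for l j
  proof -
    have "w s k * E (\<lambda>p. \<phi> s p * y p k * (x p l * y p j)) = (if s = l \<and> k = j then w s k * \<kappa> else 0)"
      if "s \<le> m + 1" "k \<in> {1..n}" for s k
    proof (cases "s = m + 1")
      case True
      then show ?thesis using top that l by auto
    next
      case False
      then have "s \<le> m" using that by simp
      then show ?thesis using E_\<phi>_xy[OF _ that(2) j l, of s] by simp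
    qed
    then have "(\<Sum>s\<le>m+1. \<Sum>k=1..n. w s k * E (\<lambda>p. \<phi> s p * y p k * (x p l * y p j)))
      = (\<Sum>s\<le>m+1. \<Sum>k=1..n. if s = l \<and> k = j then w s k * \<kappa> else 0)"
      by (intro sum.cong refl) auto
    then show ?thesis using test[of "\<lambda>p. x p l * y p j"] fxy[OF j l] delta[of l j] l j \<kappa> by simp
  qed
  show ?thesis using top[OF k] mid[OF _ k, of s] s by (cases "s = m + 1") auto
qed

definition W :: "('p \<Rightarrow> complex) set" where
  "W = {f. \<exists>u. \<forall>p\<in>S. f p = (\<Sum>k=1..n. u k * y p k)}"

lemma E_W_x_xy:
  assumes "i \<in> {1..m}" "l \<in> {1..m}" "j \<in> {1..n}"
  shows "E (\<lambda>p. (\<Sum>k=1..n. u k * y p k) * x p i * (x p l * y p j)) = (if i = l then u j * \<kappa> else 0)"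
proof -
  have "E (\<lambda>p. (\<Sum>k=1..n. u k * y p k) * x p i * (x p l * y p j))
      = (\<Sum>k=1..n. u k * E (\<lambda>p. x p i * x p l * y p k * y p j))"
    unfolding E_scale[symmetric] E_sum[symmetric] sum_distrib_right
    by (intro E_cong sum.cong refl) (simp only: mult_ac)
  also have "\<dots> = (\<Sum>k=1..n. if k = j then (if i = l then u j * \<kappa> else 0) else 0)"
    by (intro sum.cong refl) (use assms in \<open>auto simp: E_xxyy\<close>)
  finally show ?thesis using assms(3) by simp
qed

text \<open>
  Pairing both sides with \<open>x\<^sub>i y\<^sub>j\<close> reads off the \<open>j\<close>-th coefficient of \<open>f\<close> on the left and gives zero on the right.
\<close>
lemma x_independent_over_W:
  assumes "f \<in> W" "g \<in> W" and eq: "\<And>p. p \<in> S \<Longrightarrow> f p * x p i = g p * x p l"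
    and "i \<in> {1..m}" "l \<in> {1..m}" "i \<noteq> l" and "p \<in> S"
  shows "f p = 0"
proof -
  obtain u v where u: "\<And>p. p \<in> S \<Longrightarrow> f p = (\<Sum>k=1..n. u k * y p k)"
    and v: "\<And>p. p \<in> S \<Longrightarrow> g p = (\<Sum>k=1..n. v k * y p k)"
    using assms(1,2) unfolding W_def by blast
  have "u j = 0" if j: "j \<in> {1..n}" for j
  proof -
    have "u j * \<kappa> = E (\<lambda>p. (\<Sum>k=1..n. u k * y p k) * x p i * (x p i * y p j))"
      using E_W_x_xy[of i i j u] assms(4) j by simp
    also have "\<dots> = E (\<lambda>p. (\<Sum>k=1..n. v k * y p k) * x p l * (x p i * y p j))"
      by (rule E_cong) (metis eq u v)
    also have "\<dots> = 0"
      using E_W_x_xy[of l i j v] assms(4-6) j by simp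
    finally show ?thesis using \<kappa> by simp
  qed
  then show ?thesis using u[OF \<open>p \<in> S\<close>] by simp
qed

lemma zero_in_W: "(\<lambda>p. 0) \<in> W"
  unfolding W_def by (auto intro: exI[of _ "\<lambda>_. 0"])

lemma y_independent:
  assumes "\<And>p. p \<in> S \<Longrightarrow> (\<Sum>k=1..n. u k * y p k) = 0" and j: "j \<in> {1..n}"
  shows "u j = 0"
proof -
  have "u j * \<kappa> = E (\<lambda>p. (\<Sum>k=1..n. u k * y p k) * x p 1 * (x p 1 * y p j))"
    using E_W_x_xy[of 1 1 j u] m3 j by simp
  also have "\<dots> = E (\<lambda>p. 0)"
    by (rule E_cong) (simp only: assms(1) mult_zero_left)
  finally show ?thesis using \<kappa> by simp
qed

text \<open>
  The functions \<open>\<phi> s p * y p k\<close> together with \<open>f\<close> are more than \<open>card S\<close> many, hence dependent. The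
  hypotheses on \<open>f\<close> leave only \<open>f\<close> and the \<open>y\<^sub>k\<close> in the relation, and \<open>f\<close> must occur because the \<open>y\<^sub>k\<close>
  are independent.
\<close>
lemma in_W_if_few_points:
  assumes few: "card S \<le> n * (m + 2)"
    and fy: "\<And>j. j \<in> {1..n} \<Longrightarrow> E (\<lambda>p. f p * y p j) = 0"
    and fxy: "\<And>j l. \<lbrakk>j \<in> {1..n}; l \<in> {1..m}\<rbrakk> \<Longrightarrow> E (\<lambda>p. f p * (x p l * y p j)) = 0"
  shows "f \<in> W"
proof -
  define I where "I = {..m+1} \<times> {1..n}"
  \<comment> \<open>The index \<open>None\<close> stands for \<open>f\<close>.\<close>
  define G where "G z p = (case z of None \<Rightarrow> f p | Some (s, k) \<Rightarrow> \<phi> s p * y p k)" for z p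
  have finI: "finite I" and "card I = n * (m + 2)" by (simp_all add: I_def)
  then have "card S < card (insert None (Some ` I))"
    using few by (simp add: card_image)
  then obtain d where nz: "\<exists>z\<in>insert None (Some ` I). d z \<noteq> 0"
    and d: "\<And>p. p \<in> S \<Longrightarrow> (\<Sum>z\<in>insert None (Some ` I). d z * G z p) = 0"
    using exists_nontrivial_relation[OF fin, of "insert None (Some ` I)" G] finI by auto
  define w where "w s k = d (Some (s, k))" for s k
  have rel: "d None * f p + (\<Sum>s\<le>m+1. \<Sum>k=1..n. w s k * (\<phi> s p * y p k)) = 0" if "p \<in> S" for p
  proof -
    have "(\<Sum>z\<in>insert None (Some ` I). d z * G z p) = d None * f p + (\<Sum>z\<in>I. d (Some z) * G (Some z) p)"
      using finI by (simp add: G_def sum.reindex)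
    also have "(\<Sum>z\<in>I. d (Some z) * G (Some z) p) = (\<Sum>s\<le>m+1. \<Sum>k=1..n. w s k * (\<phi> s p * y p k))"
      unfolding I_def sum.cartesian_product by (rule sum.cong) (auto simp: G_def w_def)
    finally show ?thesis using d[OF that] by simp
  qed
  have w0: "w s k = 0" if "1 \<le> s" "s \<le> m + 1" "k \<in> {1..n}" for s k
    using relation_coefficients_zero[OF rel fy fxy that] by simp
  have lin: "d None * f p + (\<Sum>k=1..n. w 0 k * y p k) = 0" if "p \<in> S" for p
  proof -
    have "(\<Sum>s\<le>m+1. \<Sum>k=1..n. w s k * (\<phi> s p * y p k)) = (\<Sum>s\<in>{0}. \<Sum>k=1..n. w s k * (\<phi> s p * y p k))"
      by (rule sum.mono_neutral_right) (auto simp: w0)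
    then show ?thesis using rel[OF that] by (simp add: \<phi>_def)
  qed
  have "d None \<noteq> 0"
  proof
    assume a: "d None = 0"
    then have "w 0 k = 0" if "k \<in> {1..n}" for k
      using y_independent[of "w 0" k] lin that by simp
    then have "w s k = 0" if "s \<le> m + 1" "k \<in> {1..n}" for s k
      using w0[of s k] that by (cases "s = 0") auto
    then show False using nz a by (auto simp: I_def w_def)
  qed
  then have "f p = (\<Sum>k=1..n. (- w 0 k / d None) * y p k)" if "p \<in> S" for p
  proof -
    have "d None * f p = - (\<Sum>k=1..n. w 0 k * y p k)" using lin[OF that] by (simp add: eq_neg_iff_add_eq_0)
    then have "f p = - (\<Sum>k=1..n. w 0 k * y p k) / d None"
      using \<open>d None \<noteq> 0\<close> by (simp add: field_simps)
    then show ?thesis by (simp add: sum_divide_distrib sum_negf)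
  qed
  then show ?thesis unfolding W_def by (auto intro!: exI[of _ "\<lambda>k. - w 0 k / d None"])
qed

text \<open>
  With at most \<open>n (m + 2)\<close> points, multiplication by the \<open>x\<^sub>i\<close> satisfies relations over \<open>W\<close> that
  associativity turns into \<open>x\<^sub>1 = 0\<close>. Three different indices are needed to compare
  \<open>(x\<^sub>2 x\<^sub>3) x\<^sub>1\<close> with \<open>(x\<^sub>1 x\<^sub>3) x\<^sub>2\<close>.
\<close>
theorem card_gt: "n * (m + 2) < card S"
proof (rule ccontr)
  assume "\<not> n * (m + 2) < card S"
  then have few: "card S \<le> n * (m + 2)" by simp
  have mono: "(\<lambda>p. x p i * x p l) \<in> W" if "i \<in> {1..m}" "l \<in> {1..m}" "i \<noteq> l" for i l
  proof (rule in_W_if_few_points[OF few])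
    show "E (\<lambda>p. x p i * x p l * y p j) = 0" if "j \<in> {1..n}" for j
      using E_xxy that \<open>i \<in> _\<close> \<open>l \<in> _\<close> \<open>i \<noteq> l\<close> by simp
    show "E (\<lambda>p. x p i * x p l * (x p q * y p j)) = 0" if "j \<in> {1..n}" "q \<in> {1..m}" for j q
      using E_xxxy[of i l q j] that \<open>i \<in> _\<close> \<open>l \<in> _\<close> by (simp add: mult.assoc)
  qed
  have diff: "(\<lambda>p. x p 1 * x p 1 - x p 3 * x p 3) \<in> W"
  proof (rule in_W_if_few_points[OF few])
    show "E (\<lambda>p. (x p 1 * x p 1 - x p 3 * x p 3) * y p j) = 0" if "j \<in> {1..n}" for j
      using m3 that by (simp add: left_diff_distrib E_diff E_xxy)
    show "E (\<lambda>p. (x p 1 * x p 1 - x p 3 * x p 3) * (x p q * y p j)) = 0" if "j \<in> {1..n}" "q \<in> {1..m}" for j q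
      using E_xxxy[of 1 1 q j] E_xxxy[of 3 3 q j] m3 that by (simp add: left_diff_distrib E_diff mult.assoc)
  qed
  have in_range: "1 \<in> {1..m}" "2 \<in> {1..m}" "3 \<in> {1..m}" using m3 by auto
  have x23: "x p 2 * x p 3 = 0" if "p \<in> S" for p
    by (rule x_independent_over_W[of _ "\<lambda>p. x p 1 * x p 3" 1 2 p])
      (use mono in_range that in \<open>auto simp: mult_ac\<close>)
  have x13: "x p 1 * x p 3 = 0" if "p \<in> S" for p
    by (rule x_independent_over_W[of _ "\<lambda>p. x p 2 * x p 3" 2 1 p])
      (use mono in_range that in \<open>auto simp: mult_ac\<close>)
  have x12: "x p 1 * x p 2 = 0" if "p \<in> S" for p
    by (rule x_independent_over_W[of _ "\<lambda>p. x p 1 * x p 3" 3 2 p])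
      (use mono in_range that in \<open>auto simp: mult_ac\<close>)
  have sq: "x p 1 * x p 1 - x p 3 * x p 3 = 0" if "p \<in> S" for p
  proof (rule x_independent_over_W[OF diff zero_in_W _ in_range(2,1) _ that])
    show "(x p 1 * x p 1 - x p 3 * x p 3) * x p 2 = 0 * x p 1" if "p \<in> S" for p
      using x12[OF that] x23[OF that] by (cases "x p 2 = 0") simp_all
  qed simp
  \<comment> \<open>Where \<open>x\<^sub>1 x\<^sub>3 = 0\<close> and \<open>x\<^sub>1\<^sup>2 = x\<^sub>3\<^sup>2\<close>, the cube of \<open>x\<^sub>1\<close> vanishes.\<close>
  have "x p 1 = 0" if "p \<in> S" for p
    using x13[OF that] sq[OF that] by auto
  then have "E (\<lambda>p. x p 1 * x p 1 * y p 1 * y p 1) = E (\<lambda>p. 0)"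
    by (intro E_cong) simp
  then show False using E_xxyy[of 1 1 1 1] m3 n1 \<kappa> by simp
qed

end


section \<open>Moments from a power sum decomposition\<close>

definition \<epsilon> :: "'v \<Rightarrow> 'v \<Rightarrow>\<^sub>0 nat" where
  "\<epsilon> v = Poly_Mapping.single v 1"

lemma linear_form_power4:
  "(\<Sum>v\<in>V. Const (c v) * Var v) ^ 4 =
    (\<Sum>(u, v, w, z)\<in>V \<times> V \<times> V \<times> V. Poly_Mapping.single (\<epsilon> u + \<epsilon> v + \<epsilon> w + \<epsilon> z) (c u * c v * c w * c z))"
proof -
  have L: "(\<Sum>v\<in>V. Const (c v) * Var v) = (\<Sum>v\<in>V. Poly_Mapping.single (\<epsilon> v) (c v))"
    by (simp add: Const_def Var_def mult_single \<epsilon>_def)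
  show ?thesis
    unfolding L power4_eq_xxxx mult.assoc sum_distrib_right
    unfolding sum_distrib_left mult_single sum.cartesian_product' prod.case
    by (simp only: add.assoc)
qed

lemma prod_power_exponent:
  assumes "finite V" "u \<in> V" "v \<in> V" "w \<in> V" "z \<in> V"
  shows "(\<Prod>a\<in>V. c a ^ Poly_Mapping.lookup (\<epsilon> u + \<epsilon> v + \<epsilon> w + \<epsilon> z) a) = c u * c v * c w * (c z :: complex)"
proof -
  have "(\<Prod>a\<in>V. c a ^ Poly_Mapping.lookup (\<epsilon> b) a) = c b" if "b \<in> V" for b
  proof -
    have "(\<Prod>a\<in>V. c a ^ Poly_Mapping.lookup (\<epsilon> b) a) = (\<Prod>a\<in>V. if a = b then c a else 1)"
      by (rule prod.cong) (auto simp: lookup_single \<epsilon>_def)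
    then show ?thesis using assms(1) that by simp
  qed
  then show ?thesis using assms by (simp add: lookup_add power_add prod.distrib)
qed

text \<open>
  For a quartic monomial \<open>t\<close> in the variables \<open>V\<close>, the number of arrangements is its multinomial coefficient.
\<close>
definition arrangements :: "'v set \<Rightarrow> ('v \<Rightarrow>\<^sub>0 nat) \<Rightarrow> ('v \<times> 'v \<times> 'v \<times> 'v) set" where
  "arrangements V t = {(u, v, w, z) \<in> V \<times> V \<times> V \<times> V. \<epsilon> u + \<epsilon> v + \<epsilon> w + \<epsilon> z = t}"

lemma finite_arrangements: "finite V \<Longrightarrow> finite (arrangements V t)"
  unfolding arrangements_def by (rule finite_subset[of _ "V \<times> V \<times> V \<times> V"]) auto

lemma lookup_quartic_term:
  assumes "finite V"
  shows "Poly_Mapping.lookup (Const a * (\<Sum>v\<in>V. Const (c v) * Var v) ^ 4) t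
    = of_nat (card (arrangements V t)) * (a * (\<Prod>v\<in>V. c v ^ Poly_Mapping.lookup t v))"
proof -
  have "Poly_Mapping.lookup (Const a * (\<Sum>v\<in>V. Const (c v) * Var v) ^ 4) t
    = (\<Sum>(u, v, w, z)\<in>V \<times> V \<times> V \<times> V. a * (c u * c v * c w * c z) when \<epsilon> u + \<epsilon> v + \<epsilon> w + \<epsilon> z = t)"
    unfolding linear_form_power4
    by (simp add: Const_def sum_distrib_left lookup_sum mult_single lookup_single case_prod_unfold)
  also have "\<dots> = (\<Sum>(u, v, w, z)\<in>arrangements V t. a * (\<Prod>v\<in>V. c v ^ Poly_Mapping.lookup t v))"
  proof (rule sum.mono_neutral_cong_right)
    show "finite (V \<times> V \<times> V \<times> V)" using assms by simp
  qed (auto simp: arrangements_def prod_power_exponent[OF assms])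
  also have "\<dots> = (\<Sum>_\<in>arrangements V t. a * (\<Prod>v\<in>V. c v ^ Poly_Mapping.lookup t v))"
    by (simp add: case_prod_unfold)
  finally show ?thesis by simp
qed

text \<open>
  All arrangements of a monomial contribute the same product of coefficients of \<open>L\<close>, so the
  multinomial factor can be divided out.
\<close>
lemma moment_of_power_sum:
  assumes V: "finite V" "u \<in> V" "v \<in> V" "w \<in> V" "z \<in> V"
    and F: "F = (\<Sum>i<r. Const (\<alpha> i) * (\<Sum>v\<in>V. Const (C i v) * Var v) ^ 4)"
  shows "(\<Sum>i<r. \<alpha> i * (C i u * C i v * C i w * C i z))
    = Poly_Mapping.lookup F (\<epsilon> u + \<epsilon> v + \<epsilon> w + \<epsilon> z) / of_nat (card (arrangements V (\<epsilon> u + \<epsilon> v + \<epsilon> w + \<epsilon> z)))"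
proof -
  let ?t = "\<epsilon> u + \<epsilon> v + \<epsilon> w + \<epsilon> z"
  \<comment> \<open>The factor is nonzero because the given arrangement is one of those counted.\<close>
  have "(u, v, w, z) \<in> arrangements V ?t"
    using V by (simp add: arrangements_def)
  then have "card (arrangements V ?t) \<noteq> 0"
    using finite_arrangements[OF V(1)] by (auto simp: card_eq_0_iff)
  moreover have "Poly_Mapping.lookup F ?t
      = of_nat (card (arrangements V ?t)) * (\<Sum>i<r. \<alpha> i * (C i u * C i v * C i w * C i z))"
    by (simp only: F lookup_sum lookup_quartic_term[OF V(1)] prod_power_exponent[OF V] sum_distrib_left)
  ultimately show ?thesis by simp
qed

text \<open>
  Both exponents at \<open>u\<close> and at \<open>v\<close> are 2, so two of the four variables are \<open>u\<close> and the other two \<open>v\<close>.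
\<close>
lemma exponent_eq_two_squares_iff:
  assumes "u \<noteq> v"
  shows "\<epsilon> a + \<epsilon> b + \<epsilon> c + \<epsilon> d = \<epsilon> u + \<epsilon> u + \<epsilon> v + \<epsilon> v \<longleftrightarrow>
    (a, b, c, d) \<in> {(u, u, v, v), (u, v, u, v), (u, v, v, u), (v, u, u, v), (v, u, v, u), (v, v, u, u)}"
    (is "?l = ?r \<longleftrightarrow> ?R")
proof
  assume eq: "?l = ?r"
  have "Poly_Mapping.lookup ?l u = 2" "Poly_Mapping.lookup ?l v = 2"
    unfolding eq using assms by (auto simp: lookup_add lookup_single when_def \<epsilon>_def)
  then show ?R
    using assms by (auto simp: lookup_add lookup_single when_def \<epsilon>_def split: if_splits)
next
  assume ?R
  then show "?l = ?r" by (auto simp: ac_simps)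
qed

lemma card_arrangements_two_squares:
  assumes "u \<in> V" "v \<in> V" "u \<noteq> v"
  shows "card (arrangements V (\<epsilon> u + \<epsilon> u + \<epsilon> v + \<epsilon> v)) = 6"
proof -
  have "arrangements V (\<epsilon> u + \<epsilon> u + \<epsilon> v + \<epsilon> v)
      = {(u, u, v, v), (u, v, u, v), (u, v, v, u), (v, u, u, v), (v, u, v, u), (v, v, u, u)}"
    unfolding arrangements_def exponent_eq_two_squares_iff[OF assms(3)] using assms(1,2) by auto
  then show ?thesis using assms(3) by simp
qed

lemma lookup_quadric_product:
  "Poly_Mapping.lookup (quadric_product m n) t
    = (\<Sum>i=1..m. \<Sum>j=1..n. if t = \<epsilon> (Inl i) + \<epsilon> (Inl i) + \<epsilon> (Inr j) + \<epsilon> (Inr j) then 1 else 0)"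
proof -
  have "quadric_product m n
      = (\<Sum>i=1..m. \<Sum>j=1..n. Poly_Mapping.single (\<epsilon> (Inl i) + \<epsilon> (Inl i) + \<epsilon> (Inr j) + \<epsilon> (Inr j)) 1)"
    by (simp add: quadric_product_def Var_def power2_eq_square sum_product mult_single add.assoc \<epsilon>_def)
  then show ?thesis
    by (simp add: lookup_sum lookup_single when_def eq_commute[of t])
qed

section \<open>The lower bound\<close>

text \<open>
  The points of the decomposition with nonzero \<open>y\<close>-part, scaled by \<open>1 / T p\<close> with weights scaled by
  \<open>T p ^ 4\<close>, have the moments required above with common factor \<open>1 / 6\<close>: the coefficient 1 of
  \<open>x\<^sub>i\<^sup>2 y\<^sub>j\<^sup>2\<close> divided by its multinomial coefficient.
\<close>
lemma quadric_product_decomposition_length: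
  assumes m: "3 \<le> m" and n: "1 \<le> n"
    and L: "\<And>i. i < r \<Longrightarrow> L i \<in> linear_forms (xy_vars m n)"
    and F: "quadric_product m n = (\<Sum>i<r. Const (\<alpha> i) * L i ^ 4)"
  shows "n * (m + 2) < r"
proof -
  define V where "V = xy_vars m n"
  have V [simp]: "finite V" "Inl i \<in> V \<longleftrightarrow> i \<in> {1..m}" "Inr j \<in> V \<longleftrightarrow> j \<in> {1..n}" for i j
    by (auto simp: V_def xy_vars_def)
  have ex: "\<forall>i\<in>{..<r}. \<exists>c. L i = (\<Sum>v\<in>V. Const (c v) * Var v)"
    using L unfolding linear_forms_def V_def by blast
  then obtain C where C: "\<And>i. i < r \<Longrightarrow> L i = (\<Sum>v\<in>V. Const (C i v) * Var v)"
    using bchoice[OF ex] by auto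
  then have F': "quadric_product m n = (\<Sum>i<r. Const (\<alpha> i) * (\<Sum>v\<in>V. Const (C i v) * Var v) ^ 4)"
    using F by simp
  note moment = moment_of_power_sum[OF V(1) _ _ _ _ F', unfolded lookup_quadric_product]
  define S where "S = {p. p < r \<and> (\<exists>k\<in>{1..n}. C p (Inr k) \<noteq> 0)}"
  have fin: "finite S" and S: "S \<subseteq> {..<r}" by (auto simp: S_def)
  obtain c where c: "\<And>p. p \<in> S \<Longrightarrow> (\<Sum>k=1..n. c k * C p (Inr k)) \<noteq> 0"
    using exists_form_avoiding_zeros[OF fin, of n "\<lambda>p k. C p (Inr k)"] by (auto simp: S_def)
  define T where "T p = (\<Sum>k=1..n. c k * C p (Inr k))" for p
  have T: "T p \<noteq> 0" if "p \<in> S" for p using c that by (simp add: T_def)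
  have restrict: "(\<Sum>p\<in>S. \<alpha> p * T p ^ 4 * (C p u / T p * (C p v / T p) * (C p w / T p) * (C p (Inr k) / T p)))
      = (\<Sum>p<r. \<alpha> p * (C p u * C p v * C p w * C p (Inr k)))" if "k \<in> {1..n}" for u v w k
  proof (rule sum.mono_neutral_cong_left)
    show "\<forall>p\<in>{..<r} - S. \<alpha> p * (C p u * C p v * C p w * C p (Inr k)) = 0"
      using that by (auto simp: S_def)
    show "\<alpha> p * T p ^ 4 * (C p u / T p * (C p v / T p) * (C p w / T p) * (C p (Inr k) / T p))
        = \<alpha> p * (C p u * C p v * C p w * C p (Inr k))" if "p \<in> S" for p
      using T[OF that] by (simp add: power4_eq_xxxx)
  qed (use S in auto)
  interpret biquadratic_moments m n S "\<lambda>p. \<alpha> p * T p ^ 4" "\<lambda>p i. C p (Inl i) / T p" "\<lambda>p j. C p (Inr j) / T p" c "1/6"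
  proof
    show "(\<Sum>k=1..n. c k * (C p (Inr k) / T p)) = 1" if "p \<in> S" for p
    proof -
      have "(\<Sum>k=1..n. c k * (C p (Inr k) / T p)) = T p / T p"
        unfolding times_divide_eq_right sum_divide_distrib[symmetric] T_def ..
      then show ?thesis using T[OF that] by simp
    qed
  next
    fix j k l q assume j: "j \<in> {1..n}" "k \<in> {1..n}" "l \<in> {1..n}" "q \<in> {1..n}"
    then show "(\<Sum>p\<in>S. \<alpha> p * T p ^ 4 * (C p (Inr j) / T p * (C p (Inr k) / T p) * (C p (Inr l) / T p) * (C p (Inr q) / T p))) = 0"
      by (simp only: restrict) (simp add: moment exponent_eq_two_squares_iff)
  next
    fix i j k l assume j: "i \<in> {1..m}" "j \<in> {1..n}" "k \<in> {1..n}" "l \<in> {1..n}"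
    then show "(\<Sum>p\<in>S. \<alpha> p * T p ^ 4 * (C p (Inl i) / T p * (C p (Inr j) / T p) * (C p (Inr k) / T p) * (C p (Inr l) / T p))) = 0"
      by (simp only: restrict) (simp add: moment exponent_eq_two_squares_iff)
  next
    fix i l q j assume j: "i \<in> {1..m}" "l \<in> {1..m}" "q \<in> {1..m}" "j \<in> {1..n}"
    then show "(\<Sum>p\<in>S. \<alpha> p * T p ^ 4 * (C p (Inl i) / T p * (C p (Inl l) / T p) * (C p (Inl q) / T p) * (C p (Inr j) / T p))) = 0"
      by (simp only: restrict) (simp add: moment exponent_eq_two_squares_iff)
  next
    fix i l j k assume j: "i \<in> {1..m}" "l \<in> {1..m}" "j \<in> {1..n}" "k \<in> {1..n}"
    let ?t = "\<epsilon> (Inl i) + \<epsilon> (Inl l) + \<epsilon> (Inr j) + \<epsilon> (Inr k)"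
    have "(\<Sum>i'=1..m. \<Sum>j'=1..n. if ?t = \<epsilon> (Inl i') + \<epsilon> (Inl i') + \<epsilon> (Inr j') + \<epsilon> (Inr j') then 1 else 0)
        = (\<Sum>i'=1..m. if i' = i then \<Sum>j'=1..n. if j' = j then if i = l \<and> j = k then 1 else 0 else 0 else (0::complex))"
      by (intro sum.cong refl) (auto simp: exponent_eq_two_squares_iff intro!: sum.cong sum.neutral)
    also have "\<dots> = (if i = l \<and> j = k then 1 else 0)"
      using j by (simp del: One_nat_def)
    finally have coeff: "(\<Sum>i'=1..m. \<Sum>j'=1..n. if ?t = \<epsilon> (Inl i') + \<epsilon> (Inl i') + \<epsilon> (Inr j') + \<epsilon> (Inr j') then 1 else 0)
        = (if i = l \<and> j = k then 1 else (0::complex))" .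
    have "(\<Sum>p<r. \<alpha> p * (C p (Inl i) * C p (Inl l) * C p (Inr j) * C p (Inr k)))
        = (if i = l \<and> j = k then 1 / 6 else 0)"
      using moment[of "Inl i" "Inl l" "Inr j" "Inr k"] j card_arrangements_two_squares[of "Inl i" V "Inr j"]
      unfolding coeff by auto
    then show "(\<Sum>p\<in>S. \<alpha> p * T p ^ 4 * (C p (Inl i) / T p * (C p (Inl l) / T p) * (C p (Inr j) / T p) * (C p (Inr k) / T p)))
        = (if i = l \<and> j = k then 1 / 6 else 0)"
      by (simp only: restrict[OF j(4)])
  qed (use fin m n in auto)
  have "card S \<le> r" using card_mono[OF _ S] by simp
  then show ?thesis using card_gt by simp
qed

section \<open>The upper bound\<close>

lemma exists_nontrivial_root_of_unity:
  assumes "2 \<le> N"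
  shows "\<exists>z::complex. z \<noteq> 0 \<and> (\<Sum>i=1..N. z ^ i) = 0 \<and> (\<Sum>i=1..N. (1 / z) ^ i) = 0"
proof -
  have "card {z::complex. z ^ N = 1} = N" using assms by (intro card_roots_unity_eq) simp
  then have "\<not> {z::complex. z ^ N = 1} \<subseteq> {1}"
    using assms card_mono[of "{1}" "{z::complex. z ^ N = 1}"] by auto
  then obtain z :: complex where z: "z ^ N = 1" "z \<noteq> 1" by blast
  have geom: "(\<Sum>i=1..N. w ^ i) = 0" if "w ^ N = 1" "w \<noteq> 1" for w :: complex
  proof -
    have "(1 - w) * (\<Sum>i<N. w ^ i) = 0" using one_diff_power_eq[of w N] that by simp
    then have "(\<Sum>i<N. w ^ i) = 0" using that by simp
    then have "w * (\<Sum>i<N. w ^ i) = 0" by simp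
    moreover have "w * (\<Sum>i<N. w ^ i) = (\<Sum>i=1..N. w ^ i)"
      by (simp add: sum_distrib_left sum.atLeast1_atMost_eq)
    ultimately show ?thesis by simp
  qed
  have "z \<noteq> 0" using z assms by (metis not_numeral_le_zero power_0_left zero_neq_one)
  moreover have "(1 / z) ^ N = 1" "1 / z \<noteq> 1" using z by (simp_all add: power_divide)
  ultimately show ?thesis using geom[OF z] geom[of "1 / z"] by blast
qed

lemma decomposition_indexed_by_nat:
  assumes "finite K" and L: "\<forall>k\<in>K. L k \<in> linear_forms V"
    and F: "F = (\<Sum>k\<in>K. Const (\<alpha> k) * L k ^ d)"
  shows "\<exists>\<alpha> L. (\<forall>i<card K. L i \<in> linear_forms V) \<and> F = (\<Sum>i<card K. Const (\<alpha> i) * L i ^ d)"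
proof -
  obtain h where h: "bij_betw h {..<card K} K"
    using ex_bij_betw_nat_finite[OF assms(1)] by (auto simp: atLeast0LessThan)
  have "F = (\<Sum>i<card K. Const (\<alpha> (h i)) * L (h i) ^ d)"
    unfolding F by (rule sum.reindex_bij_betw[OF h, symmetric])
  moreover have "\<forall>i<card K. L (h i) \<in> linear_forms V"
    using h L by (auto simp: bij_betw_def)
  ultimately show ?thesis
    by (intro exI[of _ "\<lambda>i. \<alpha> (h i)"] exI[of _ "\<lambda>i. L (h i)"]) simp
qed

lemma binomial_in_linear_forms:
  assumes "finite V" "u \<in> V" "v \<in> V" "u \<noteq> v"
  shows "Var u + Const a * Var v \<in> linear_forms V"
proof -
  define c where "c w = (if w = u then 1 else if w = v then a else 0)" for w
  have "(\<Sum>w\<in>V. Const (c w) * Var w) = (\<Sum>w\<in>{u, v}. Const (c w) * Var w)"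
    using assms by (intro sum.mono_neutral_right) (auto simp: c_def Const_def)
  also have "\<dots> = Var u + Const a * Var v"
    using assms by (simp add: c_def Const_def)
  finally show ?thesis unfolding linear_forms_def by (metis (mono_tags, lifting) mem_Collect_eq)
qed

lemma Const_mult: "Const (a * b) = Const a * Const b"
  by (simp add: Const_def mult_single)

lemma Const_add: "Const (a + b) = Const a + Const b"
  by (simp add: Const_def single_add)

lemma Const_uminus: "Const (- a) = - Const a"
  by (simp add: Const_def single_uminus)

lemma Const_sum: "Const (sum f A) = (\<Sum>a\<in>A. Const (f a))"
  by (induction A rule: infinite_finite_induct) (simp_all add: Const_def single_add)

lemma Const_0: "Const 0 = 0" and Const_1: "Const 1 = 1"
  by (simp_all add: Const_def)

lemma Const_numeral: "Const (numeral k) = numeral k"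
  by (simp add: Const_def)

lemma sum_of_opposite_fourth_powers:
  fixes X Z :: "'a::comm_ring_1"
  shows "(X + Z) ^ 4 + (X - Z) ^ 4 = 2 * X ^ 4 + 12 * (X ^ 2 * Z ^ 2) + 2 * Z ^ 4"
  by (simp add: power4_eq_xxxx power2_eq_square algebra_simps)

lemma square_product_as_powers:
  assumes "s \<noteq> 0" "c ^ 2 = s"
  shows "Const (1 / (12 * s)) * (X + Const c * Y) ^ 4 + Const (1 / (12 * s)) * (X + Const (- c) * Y) ^ 4
    = X ^ 2 * Y ^ 2 + Const (1 / 6) * Const (1 / s) * X ^ 4 + Const (1 / 6) * Const s * Y ^ 4"
proof -
  let ?a = "1 / (12 * s)"
  have "Const ?a * (X + Const c * Y) ^ 4 + Const ?a * (X + Const (- c) * Y) ^ 4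
    = (Const ?a * (Const c) ^ 2 * 12) * (X ^ 2 * Y ^ 2) + (Const ?a * 2) * X ^ 4 + (Const ?a * (Const c)^2 * (Const c)^2 * 2) * Y ^ 4"
    using arg_cong[OF sum_of_opposite_fourth_powers[of X "Const c * Y"], of "\<lambda>p. Const ?a * p"]
    by (simp add: Const_uminus algebra_simps power_mult_distrib power4_eq_xxxx power2_eq_square)
  also have "Const ?a * (Const c) ^ 2 * 12 = Const (?a * c ^ 2 * 12)"
    by (simp only: Const_mult power2_eq_square Const_numeral)
  also have "?a * c ^ 2 * 12 = 1" using assms by simp
  also have "Const ?a * 2 = Const (?a * 2)"
    by (simp only: Const_mult Const_numeral)
  also have "?a * 2 = 1 / 6 * (1 / s)" by simp
  also have "Const ?a * (Const c)^2 * (Const c)^2 * 2 = Const (?a * c ^ 2 * c ^ 2 * 2)"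
    by (simp only: Const_mult power2_eq_square Const_numeral)
  also have "?a * c ^ 2 * c ^ 2 * 2 = 1 / 6 * s" using assms by (simp add: field_simps)
  finally show ?thesis by (simp only: Const_mult Const_1 mult_1)
qed

text \<open>
  The pure powers \<open>x\<^sub>i\<^sup>4\<close> and \<open>y\<^sub>j\<^sup>4\<close> cancel because the rows of \<open>1 / s\<close> and the columns of \<open>s\<close> sum to
  zero. The index set has one pair \<open>(i, j)\<close> for each product of squares and one truth value for each sign.
\<close>
lemma quadric_product_decomposition:
  assumes "2 \<le> m" "2 \<le> n"
  shows "\<exists>\<alpha> L. (\<forall>k\<in>({1..m} \<times> {1..n}) \<times> (UNIV :: bool set). L k \<in> linear_forms (xy_vars m n)) \<and>
    quadric_product m n = (\<Sum>k\<in>({1..m} \<times> {1..n}) \<times> UNIV. Const (\<alpha> k) * L k ^ 4)"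
proof -
  obtain \<omega> :: complex where \<omega>: "\<omega> \<noteq> 0" "(\<Sum>i=1..m. \<omega> ^ i) = 0" "(\<Sum>i=1..m. (1 / \<omega>) ^ i) = 0"
    using exists_nontrivial_root_of_unity[OF assms(1)] by blast
  obtain \<zeta> :: complex where \<zeta>: "\<zeta> \<noteq> 0" "(\<Sum>j=1..n. \<zeta> ^ j) = 0" "(\<Sum>j=1..n. (1 / \<zeta>) ^ j) = 0"
    using exists_nontrivial_root_of_unity[OF assms(2)] by blast
  define s where "s i j = \<omega> ^ i * \<zeta> ^ j" for i j :: nat
  define c where "c i j = csqrt (s i j)" for i j
  have s: "s i j \<noteq> 0" and c: "c i j ^ 2 = s i j" for i j
    using \<omega> \<zeta> by (simp_all add: s_def c_def)
  have rows: "(\<Sum>j=1..n. 1 / s i j) = 0" for i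
  proof -
    have "(\<Sum>j=1..n. 1 / s i j) = 1 / \<omega> ^ i * (\<Sum>j=1..n. (1 / \<zeta>) ^ j)"
      by (simp add: s_def sum_distrib_left power_divide)
    then show ?thesis by (simp only: \<zeta> mult_zero_right)
  qed
  have cols: "(\<Sum>i=1..m. s i j) = 0" for j
  proof -
    have "(\<Sum>i=1..m. s i j) = (\<Sum>i=1..m. \<omega> ^ i) * \<zeta> ^ j"
      by (simp add: s_def sum_distrib_right)
    then show ?thesis by (simp only: \<omega> mult_zero_left)
  qed
  define \<alpha> :: "(nat \<times> nat) \<times> bool \<Rightarrow> complex" where "\<alpha> = (\<lambda>((i, j), b). 1 / (12 * s i j))"
  define L where "L = (\<lambda>((i, j), b). Var (Inl i) + Const (if b then c i j else - c i j) * Var (Inr j) :: (nat + nat) cpoly)"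
  let ?X = "\<lambda>i. Var (Inl i) :: (nat + nat) cpoly" and ?Y = "\<lambda>j. Var (Inr j) :: (nat + nat) cpoly"
  have "(\<Sum>k\<in>({1..m} \<times> {1..n}) \<times> UNIV. Const (\<alpha> k) * L k ^ 4)
      = (\<Sum>i=1..m. \<Sum>j=1..n. \<Sum>b\<in>UNIV. Const (\<alpha> ((i, j), b)) * L ((i, j), b) ^ 4)"
    by (simp only: sum.cartesian_product')
  also have "\<dots> = (\<Sum>i=1..m. \<Sum>j=1..n. ?X i ^ 2 * ?Y j ^ 2
      + Const (1 / 6) * Const (1 / s i j) * ?X i ^ 4 + Const (1 / 6) * Const (s i j) * ?Y j ^ 4)"
  proof (intro sum.cong refl)
    fix i j
    show "(\<Sum>b\<in>UNIV. Const (\<alpha> ((i, j), b)) * L ((i, j), b) ^ 4) = ?X i ^ 2 * ?Y j ^ 2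
      + Const (1 / 6) * Const (1 / s i j) * ?X i ^ 4 + Const (1 / 6) * Const (s i j) * ?Y j ^ 4"
      unfolding square_product_as_powers[OF s c, symmetric]
      by (simp add: UNIV_bool \<alpha>_def L_def add.commute)
  qed
  also have "\<dots> = (\<Sum>i=1..m. \<Sum>j=1..n. ?X i ^ 2 * ?Y j ^ 2)
      + (\<Sum>i=1..m. \<Sum>j=1..n. Const (1 / 6) * Const (1 / s i j) * ?X i ^ 4)
      + (\<Sum>i=1..m. \<Sum>j=1..n. Const (1 / 6) * Const (s i j) * ?Y j ^ 4)"
    by (simp only: sum.distrib)
  also have "(\<Sum>i=1..m. \<Sum>j=1..n. Const (1 / 6) * Const (1 / s i j) * ?X i ^ 4) = 0"
    by (simp only: rows Const_0 mult_zero_left mult_zero_right sum.neutral_const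
        flip: sum_distrib_left sum_distrib_right Const_sum)
  also have "(\<Sum>i=1..m. \<Sum>j=1..n. Const (1 / 6) * Const (s i j) * ?Y j ^ 4) = 0"
    by (subst sum.swap) (simp only: cols Const_0 mult_zero_left mult_zero_right sum.neutral_const
        flip: sum_distrib_left sum_distrib_right Const_sum)
  also have "(\<Sum>i=1..m. \<Sum>j=1..n. ?X i ^ 2 * ?Y j ^ 2) + 0 + 0 = quadric_product m n"
    by (simp add: quadric_product_def sum_product)
  finally have "quadric_product m n = (\<Sum>k\<in>({1..m} \<times> {1..n}) \<times> UNIV. Const (\<alpha> k) * L k ^ 4)" ..
  moreover have "L k \<in> linear_forms (xy_vars m n)" if "k \<in> ({1..m} \<times> {1..n}) \<times> UNIV" for k
    using that by (auto simp: L_def xy_vars_def intro!: binomial_in_linear_forms)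
  ultimately show ?thesis by blast
qed

section \<open>The rank\<close>

theorem theorem6p3:
  fixes m n :: nat
  assumes "3 \<le> m" and "m \<le> n"
  shows "n * (m + 2) < waring_rank (xy_vars m n) 4 (quadric_product m n)
       \<and> waring_rank (xy_vars m n) 4 (quadric_product m n) \<le> 2 * m * n"
proof -
  let ?K = "({1..m} \<times> {1..n}) \<times> (UNIV :: bool set)"
  let ?R = "waring_rank (xy_vars m n) 4 (quadric_product m n)"
  let ?decomposition = "\<lambda>r. \<exists>(\<alpha> :: nat \<Rightarrow> complex) (L :: nat \<Rightarrow> (nat + nat) cpoly).
    (\<forall>i<r. L i \<in> linear_forms (xy_vars m n)) \<and> quadric_product m n = (\<Sum>i<r. Const (\<alpha> i) * L i ^ 4)"
  have "2 \<le> m" "2 \<le> n" using assms by auto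
  then obtain \<alpha> L where "\<forall>k\<in>?K. L k \<in> linear_forms (xy_vars m n)"
    and "quadric_product m n = (\<Sum>k\<in>?K. Const (\<alpha> k) * L k ^ 4)"
    using quadric_product_decomposition by blast
  then have "?decomposition (card ?K)"
    by (intro decomposition_indexed_by_nat) simp_all
  then have dec: "?decomposition (2 * m * n)" by (simp add: mult_ac)
  have "?R \<le> 2 * m * n"
    unfolding waring_rank_def by (rule Least_le) (rule dec)
  moreover have "?decomposition ?R"
    unfolding waring_rank_def by (rule LeastI) (rule dec)
  then have "n * (m + 2) < ?R"
    using quadric_product_decomposition_length[of m n] assms by auto
  ultimately show ?thesis by blast
qed

end
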